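(* Let $A$ be a finite set, $f:2^A\to[0,1]$ and $c:2^A\to\mathbb{R}_{\ge0}$. For any segment $[\alpha,\beta]\subseteq[0,1]$, the recursive procedure $\mathtt{CV}(\alpha,\beta)$ (described in the context) takes time linear in the number of critical values in $[\alpha,\beta]$.
   Context: Contract setting: $A=\{1,\dots,n\}$ is a set of actions, $f:2^A\to[0,1]$ is the reward function and $c:2^A\to\mathbb{R}_{\ge0}$ is the cost function. A contract is a number $\alpha\in[0,1]$, and the agent's utility is $u_a(\alpha,S)=\alpha f(S)-c(S)$ for $S\subseteq A$. The agent's best response (demand) $S_\alpha$ is a set maximizing $u_a(\alpha,\cdot)$ over all $S\subseteq A$; ties are broken in favor of sets with larger $f$, and remaining ties are broken by a consistent rule independent of $\alpha$ (e.g. a fixed total order on the subsets of $A$). Critical values are the values of $\alpha$ at which the agent's demand changes: $\alpha\in(0,1]$ is critical if for every $\varepsilon>0$ there is $x\in[0,1]$ with $\alpha-\varepsilon<x<\alpha$ and $S_x\ne S_\alpha$ (by convention $0$ is also counted as critical). Procedure $\mathtt{CV}(\alpha,\beta)$, which has access to a demand oracle (given $\alpha$, returns $S_\alpha$) and to value oracles for $f$ and $c$: 1. If $S_\alpha=S_\beta$, return $\emptyset$. 2. Set $\gamma=\dfrac{c(S_\alpha)-c(S_\beta)}{f(S_\alpha)-f(S_\beta)}$. 3. If $S_\gamma=S_\beta$, return $\{\gamma\}$. 4. Otherwise, return $\mathtt{CV}(\alpha,\gamma)\cup\mathtt{CV}(\gamma,\beta)$. Time convention: executing the steps of one call to $\mathtt{CV}$,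 excluding its recursive calls (this includes demand-oracle and value-oracle calls, arithmetic, comparisons and forming the union), costs at most a constant $c_0$. "Linear in the number $N$ of critical values" means at most $C\,(N+1)$ for a constant $C$ depending only on $c_0$. *)

theory Defs
  imports Complex_Main
begin

definition contract_setting :: "'a set \<Rightarrow> ('a set \<Rightarrow> real) \<Rightarrow> ('a set \<Rightarrow> real) \<Rightarrow> bool" where
  "contract_setting A f c \<longleftrightarrow>
     finite A \<and> (\<forall>S\<subseteq>A. 0 \<le> f S \<and> f S \<le> 1) \<and> (\<forall>S\<subseteq>A. 0 \<le> c S)"

definition agent_utility ::
  "('a set \<Rightarrow> real) \<Rightarrow> ('a set \<Rightarrow> real) \<Rightarrow> real \<Rightarrow> 'a set \<Rightarrow> real" where
  "agent_utility f c \<alpha> S = \<alpha> * f S - c S"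

definition best_responses ::
  "'a set \<Rightarrow> ('a set \<Rightarrow> real) \<Rightarrow> ('a set \<Rightarrow> real) \<Rightarrow> real \<Rightarrow> 'a set set" where
  "best_responses A f c \<alpha> = {S. is_arg_max (agent_utility f c \<alpha>) (\<lambda>S. S \<subseteq> A) S}"

text \<open>The best responses of largest reward, i.e. those still tied after the first
  tie-breaking criterion.\<close>

definition tied_best_responses ::
  "'a set \<Rightarrow> ('a set \<Rightarrow> real) \<Rightarrow> ('a set \<Rightarrow> real) \<Rightarrow> real \<Rightarrow> 'a set set" where
  "tied_best_responses A f c \<alpha> = {S. is_arg_max f (\<lambda>S. S \<in> best_responses A f c \<alpha>) S}"

text \<open>A rule for the remaining ties selects a member of each nonempty family of tied sets.
  It sees only the family, not \<open>\<alpha>\<close>. Picking the greatest member with respect to a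
  fixed total order on the subsets of \<open>A\<close> is a special case, see
  \<open>tie_breaking_rule_of_linear_order\<close>.\<close>

definition tie_breaking_rule :: "'a set \<Rightarrow> ('a set set \<Rightarrow> 'a set) \<Rightarrow> bool" where
  "tie_breaking_rule A pick \<longleftrightarrow> (\<forall>F. F \<subseteq> Pow A \<and> F \<noteq> {} \<longrightarrow> pick F \<in> F)"

lemma tie_breaking_rule_of_linear_order:
  assumes "finite A" and "linear_order_on (Pow A) r"
  shows "tie_breaking_rule A (\<lambda>F. THE S. S \<in> F \<and> (\<forall>T\<in>F. (T, S) \<in> r))"
  unfolding tie_breaking_rule_def
proof (intro allI impI)
  fix F assume F: "F \<subseteq> Pow A \<and> F \<noteq> {}"
  have refl: "(S, S) \<in> r" if "S \<in> Pow A" for S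
  proof -
    have "refl_on (Pow A) r"
      using assms(2) by (simp add: order_on_defs)
    then show ?thesis
      using that by (rule refl_onD)
  qed
  have tot: "(S, T) \<in> r \<or> (T, S) \<in> r" if "S \<in> Pow A" "T \<in> Pow A" for S T
  proof (cases "S = T")
    case True
    then show ?thesis using refl[OF that(1)] by simp
  next
    case False
    have "total_on (Pow A) r"
      using assms(2) by (simp add: order_on_defs)
    then show ?thesis
      unfolding total_on_def using that False by blast
  qed
  have tr: "trans r" and anti: "antisym r"
    using assms(2) by (simp_all add: order_on_defs)
  have "finite F"
    using F assms(1) by (meson finite_Pow_iff finite_subset)
  then have "\<exists>S\<in>F. \<forall>T\<in>F. (T, S) \<in> r"
    using F
  proof (induction F rule: finite_induct)
    case empty
    then show ?case by simp
  next
    case (insert X F)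
    show ?case
    proof (cases "F = {}")
      case True
      then show ?thesis using refl[of X] insert.prems by simp
    next
      case False
      then obtain S where S: "S \<in> F" "\<forall>T\<in>F. (T, S) \<in> r"
        using insert.IH insert.prems by (meson insert_subset)
      have "(X, S) \<in> r \<or> (S, X) \<in> r"
        by (rule tot) (use S(1) insert.prems in blast)+
      then show ?thesis
      proof
        assume "(X, S) \<in> r"
        then show ?thesis using S by blast
      next
        assume SX: "(S, X) \<in> r"
        have "(T, X) \<in> r" if "T \<in> insert X F" for T
          using that
        proof (rule insertE)
          assume "T = X"
          then show ?thesis using refl[of X] insert.prems by simp
        next
          assume "T \<in> F"
          then have "(T, S) \<in> r" using S(2) by simp
          then show ?thesis using SX by (rule transD[OF tr])
        qed
        then show ?thesis by blast
      qed
    qed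
  qed
  then have "\<exists>!S. S \<in> F \<and> (\<forall>T\<in>F. (T, S) \<in> r)"
  proof (elim bexE)
    fix S assume S: "S \<in> F" "\<forall>T\<in>F. (T, S) \<in> r"
    show ?thesis
    proof (rule ex1I[of _ S])
      show "S \<in> F \<and> (\<forall>T\<in>F. (T, S) \<in> r)" using S by simp
    next
      fix S' assume S': "S' \<in> F \<and> (\<forall>T\<in>F. (T, S') \<in> r)"
      show "S' = S" by (rule antisymD[OF anti]) (use S S' in simp_all)
    qed
  qed
  then show "(THE S. S \<in> F \<and> (\<forall>T\<in>F. (T, S) \<in> r)) \<in> F"
    by (rule theI'[THEN conjunct1])
qed

definition demand ::
  "'a set \<Rightarrow> ('a set \<Rightarrow> real) \<Rightarrow> ('a set \<Rightarrow> real) \<Rightarrow> ('a set set \<Rightarrow> 'a set) \<Rightarrow> real \<Rightarrow> 'a set" where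
  "demand A f c pick \<alpha> = pick (tied_best_responses A f c \<alpha>)"

definition critical_values :: "(real \<Rightarrow> 'a set) \<Rightarrow> real set" where
  "critical_values D =
     insert 0 {\<alpha>. 0 < \<alpha> \<and> \<alpha> \<le> 1 \<and>
       (\<forall>\<epsilon>>0. \<exists>x\<in>{0..1}. \<alpha> - \<epsilon> < x \<and> x < \<alpha> \<and> D x \<noteq> D \<alpha>)}"

text \<open>\<open>CV_run D f c cost \<alpha> \<beta> R t\<close>: with demand oracle \<open>D\<close>, the call
  \<open>CV(\<alpha>, \<beta>)\<close> terminates, returning \<open>R\<close> after time \<open>t\<close>, where
  \<open>cost \<alpha> \<beta>\<close> is the time spent in the call itself, without its recursive calls.
  The premise \<open>f (D \<alpha>) \<noteq> f (D \<beta>)\<close> leaves an execution that would divide by zero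
  without a run, instead of giving it the value \<open>x / 0 = 0\<close>.\<close>

inductive CV_run ::
  "(real \<Rightarrow> 'a set) \<Rightarrow> ('a set \<Rightarrow> real) \<Rightarrow> ('a set \<Rightarrow> real) \<Rightarrow> (real \<Rightarrow> real \<Rightarrow> real) \<Rightarrow>
   real \<Rightarrow> real \<Rightarrow> real set \<Rightarrow> real \<Rightarrow> bool"
  for D f c cost where
  same: "CV_run D f c cost \<alpha> \<beta> {} (cost \<alpha> \<beta>)"
    if "D \<alpha> = D \<beta>"
| single: "CV_run D f c cost \<alpha> \<beta> {\<gamma>} (cost \<alpha> \<beta>)"
    if "D \<alpha> \<noteq> D \<beta>" and "f (D \<alpha>) \<noteq> f (D \<beta>)"
      and "\<gamma> = (c (D \<alpha>) - c (D \<beta>)) / (f (D \<alpha>) - f (D \<beta>))"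
      and "D \<gamma> = D \<beta>"
| split: "CV_run D f c cost \<alpha> \<beta> (R\<^sub>1 \<union> R\<^sub>2) (cost \<alpha> \<beta> + t\<^sub>1 + t\<^sub>2)"
    if "D \<alpha> \<noteq> D \<beta>" and "f (D \<alpha>) \<noteq> f (D \<beta>)"
      and "\<gamma> = (c (D \<alpha>) - c (D \<beta>)) / (f (D \<alpha>) - f (D \<beta>))"
      and "D \<gamma> \<noteq> D \<beta>"
      and "CV_run D f c cost \<alpha> \<gamma> R\<^sub>1 t\<^sub>1" and "CV_run D f c cost \<gamma> \<beta> R\<^sub>2 t\<^sub>2"

end

theory Submission
  imports Defs
begin

text \<open>If the demands at \<open>\<alpha> < \<beta>\<close> differ, then \<open>f\<close> is strictly larger at \<open>\<beta>\<close>, and the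
  contract \<open>\<gamma>\<close> at which the two demanded sets give the same utility lies in
  \<open>{\<alpha><..\<beta>}\<close>. Below \<open>\<gamma>\<close> the demand at \<open>\<alpha>\<close> beats the one at \<open>\<beta>\<close>, so \<open>\<gamma>\<close> is critical
  if its demand is the one at \<open>\<beta>\<close>. Otherwise the demand at \<open>\<gamma>\<close> lies strictly between
  the other two in reward, since the tie at \<open>\<gamma>\<close> favours the set demanded at \<open>\<beta>\<close>; hence
  each recursive call again has two different demands and, inductively, a critical value
  of its own in its half-open interval. With \<open>N\<close> critical values in \<open>{\<alpha><..\<beta>}\<close> this
  gives at most \<open>2 * N - 1\<close> calls.\<close>

locale contract =
  fixes A :: "'a set" and f c :: "'a set \<Rightarrow> real" and pick :: "'a set set \<Rightarrow> 'a set"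
  assumes finite_actions: "finite A"
    and tie_breaking: "tie_breaking_rule A pick"
begin

abbreviation D :: "real \<Rightarrow> 'a set" where
  "D \<equiv> demand A f c pick"

lemma mem_best_responses:
  "S \<in> best_responses A f c x \<longleftrightarrow> S \<subseteq> A \<and> (\<forall>T\<subseteq>A. x * f T - c T \<le> x * f S - c S)"
  unfolding best_responses_def is_arg_max_def agent_utility_def by (auto simp: not_less)

lemma mem_tied_best_responses:
  "S \<in> tied_best_responses A f c x \<longleftrightarrow>
     S \<in> best_responses A f c x \<and> (\<forall>T\<in>best_responses A f c x. f T \<le> f S)"
  unfolding tied_best_responses_def is_arg_max_def by (auto simp: not_less)

lemma tied_best_responses_nonempty: "tied_best_responses A f c x \<noteq> {}"
proof -
  have ex_max: "\<exists>S\<in>F. \<forall>T\<in>F. g T \<le> g S"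
    if "F \<subseteq> Pow A" "F \<noteq> {}" for F and g :: "'a set \<Rightarrow> real"
  proof -
    have fin: "finite F"
      using that(1) finite_actions by (meson finite_Pow_iff finite_subset)
    then have "Max (g ` F) \<in> g ` F"
      using that(2) by (intro Max_in) auto
    then obtain S where "S \<in> F" "g S = Max (g ` F)"
      by auto
    then show ?thesis
      using fin by (intro bexI[of _ S]) auto
  qed
  have "best_responses A f c x \<noteq> {}"
    using ex_max[OF order_refl Pow_not_empty, of "\<lambda>S. x * f S - c S"]
    unfolding ex_in_conv[symmetric] mem_best_responses by blast
  moreover have "best_responses A f c x \<subseteq> Pow A"
    using mem_best_responses by blast
  ultimately show ?thesis
    using ex_max[of "best_responses A f c x" f]
    unfolding ex_in_conv[symmetric] mem_tied_best_responses by blast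
qed

lemma demand_tied: "D x \<in> tied_best_responses A f c x"
proof -
  have "tied_best_responses A f c x \<subseteq> Pow A"
    using mem_tied_best_responses mem_best_responses by blast
  then show ?thesis
    using tie_breaking tied_best_responses_nonempty[of x]
    unfolding tie_breaking_rule_def demand_def by simp
qed

lemma demand_subset: "D x \<subseteq> A"
  using demand_tied mem_tied_best_responses mem_best_responses by blast

lemma demand_optimal: "T \<subseteq> A \<Longrightarrow> x * f T - c T \<le> x * f (D x) - c (D x)"
  using demand_tied mem_tied_best_responses mem_best_responses by blast

text \<open>A set that attained the same utility with a larger reward would win the first tie-break,
  so it must lose strictly in utility.\<close>

lemma demand_strictly_optimal:
  assumes "T \<subseteq> A" "f (D x) < f T"
  shows "x * f T - c T < x * f (D x) - c (D x)"
proof (rule ccontr)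
  assume "\<not> ?thesis"
  then have "T \<in> best_responses A f c x"
    using demand_optimal[of _ x] assms(1) unfolding mem_best_responses
    by (meson not_less order_trans)
  then have "f T \<le> f (D x)"
    using demand_tied[of x] unfolding mem_tied_best_responses by blast
  then show False
    using assms(2) by simp
qed

text \<open>Optimality of each demand at its own contract turns equal rewards into equal costs. The
  two tied families then coincide, and \<open>pick\<close> sees only the family, not the
  contract.\<close>

lemma demand_eqI:
  assumes "f (D x) = f (D y)"
  shows "D x = D y"
proof -
  have c_eq: "c (D x) = c (D y)"
    using demand_optimal[OF demand_subset, of x y] demand_optimal[OF demand_subset, of y x]
    unfolding assms by linarith
  \<comment> \<open>The contract enters this description only through the reward and cost of the
    demand.\<close>
  have tied: "tied_best_responses A f c z = {S. S \<subseteq> A \<and> f S = f (D z) \<and> c S = c (D z)}" for z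
  proof -
    have "S \<in> tied_best_responses A f c z \<longleftrightarrow> S \<subseteq> A \<and> f S = f (D z) \<and> c S = c (D z)" for S
    proof
      assume S: "S \<in> tied_best_responses A f c z"
      then have "f S = f (D z)"
        using demand_tied[of z] unfolding mem_tied_best_responses by (meson order_antisym)
      moreover have "S \<subseteq> A" "z * f (D z) - c (D z) \<le> z * f S - c S"
        using S demand_subset unfolding mem_tied_best_responses mem_best_responses by blast+
      ultimately show "S \<subseteq> A \<and> f S = f (D z) \<and> c S = c (D z)"
        using demand_optimal[of S z] by simp
    next
      assume "S \<subseteq> A \<and> f S = f (D z) \<and> c S = c (D z)"
      then show "S \<in> tied_best_responses A f c z"
        using demand_tied[of z] unfolding mem_tied_best_responses mem_best_responses by simp
    qed
    then show ?thesis by blast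
  qed
  show ?thesis
    unfolding demand_def using tied[of x] tied[of y] assms c_eq by simp
qed

text \<open>Adding the optimality inequalities at \<open>x\<close> and at \<open>y\<close> cancels
  the costs.\<close>

lemma reward_demand_mono:
  assumes "x \<le> y"
  shows "f (D x) \<le> f (D y)"
proof (cases "x = y")
  case False
  have "(y - x) * (f (D x) - f (D y)) \<le> 0"
    using demand_optimal[OF demand_subset, of x y] demand_optimal[OF demand_subset, of y x]
    by (simp add: algebra_simps)
  then show ?thesis
    using False assms by (simp add: mult_le_0_iff)
qed simp

lemma demand_constant_between:
  assumes "x \<le> y" "y \<le> z" "D x = D z"
  shows "D y = D z"
  using reward_demand_mono[OF assms(1)] reward_demand_mono[OF assms(2)] assms(3)
  by (intro demand_eqI) simp

text \<open>At a positive critical value \<open>y\<close> the demand changes arbitrarily close below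
  \<open>y\<close>, in particular above any smaller \<open>x\<close>. Equal demands at
  \<open>x\<close> and \<open>y\<close> would force it to be constant there.\<close>

lemma inj_on_demand_critical_values: "inj_on D (critical_values D)"
proof (rule linorder_inj_onI')
  fix x y assume x: "x \<in> critical_values D" and y: "y \<in> critical_values D" and "x < y"
  have "0 \<le> x"
    using x unfolding critical_values_def by auto
  with y \<open>x < y\<close> have "\<forall>\<epsilon>>0. \<exists>z\<in>{0..1}. y - \<epsilon> < z \<and> z < y \<and> D z \<noteq> D y"
    unfolding critical_values_def by simp
  from this[rule_format, of "y - x"] \<open>x < y\<close> obtain z where "x < z" "z < y" "D z \<noteq> D y"
    by auto
  then show "D x \<noteq> D y"
    using demand_constant_between[of x z y] by auto
qed

lemma finite_critical_values: "finite (critical_values D)"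
proof (rule inj_on_finite[OF inj_on_demand_critical_values])
  show "D ` critical_values D \<subseteq> Pow A"
    using demand_subset by blast
  show "finite (Pow A)"
    using finite_actions by simp
qed

lemma CV_run_linear_time:
  assumes cost: "\<And>x y. cost x y \<le> c0" and cost_nonneg: "0 \<le> c0"
    and "0 \<le> \<alpha>" "\<alpha> \<le> \<beta>" "\<beta> \<le> 1" "D \<alpha> \<noteq> D \<beta>"
  shows "critical_values D \<inter> {\<alpha><..\<beta>} \<noteq> {} \<and>
    (\<exists>R t. CV_run D f c cost \<alpha> \<beta> R t \<and>
      t \<le> c0 * (2 * real (card (critical_values D \<inter> {\<alpha><..\<beta>})) - 1))"
proof -
  \<comment> \<open>The size of this family is the termination measure: interval lengths are real
    numbers, but only finitely many sets have a reward in the given range.\<close>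
  define F where "F x y = {S. S \<subseteq> A \<and> f (D x) < f S \<and> f S \<le> f (D y)}" for x y
  show ?thesis
    using assms(3-)
  proof (induction "card (F \<alpha> \<beta>)" arbitrary: \<alpha> \<beta> rule: less_induct)
    case less
    define \<gamma> where "\<gamma> = (c (D \<alpha>) - c (D \<beta>)) / (f (D \<alpha>) - f (D \<beta>))"
    have lt: "f (D \<alpha>) < f (D \<beta>)"
      using reward_demand_mono[OF less.prems(2)] demand_eqI less.prems(4) by fastforce
    then have f_ne: "f (D \<alpha>) \<noteq> f (D \<beta>)" by simp
    have \<gamma>_tie: "\<gamma> * f (D \<alpha>) - c (D \<alpha>) = \<gamma> * f (D \<beta>) - c (D \<beta>)"
      using f_ne unfolding \<gamma>_def by (simp add: field_simps)
    \<comment> \<open>The utility gap between the two sets is affine in the contract, vanishes at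
      \<gamma> and has positive slope, so its sign locates a contract relative to \<gamma>.\<close>
    have scaled: "(x - \<gamma>) * (f (D \<beta>) - f (D \<alpha>))
        = (x * f (D \<beta>) - c (D \<beta>)) - (x * f (D \<alpha>) - c (D \<alpha>))" for x
      using \<gamma>_tie by (simp add: algebra_simps)
    have "(\<alpha> - \<gamma>) * (f (D \<beta>) - f (D \<alpha>)) < 0"
      using demand_strictly_optimal[OF demand_subset lt] unfolding scaled by simp
    then have \<alpha>\<gamma>: "\<alpha> < \<gamma>"
      using lt by (simp add: mult_less_0_iff)
    have "0 \<le> (\<beta> - \<gamma>) * (f (D \<beta>) - f (D \<alpha>))"
      using demand_optimal[OF demand_subset, of \<beta> \<alpha>] unfolding scaled by simp
    then have \<gamma>\<beta>: "\<gamma> \<le> \<beta>"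
      using lt by (simp add: zero_le_mult_iff)
    show ?case
    proof (cases "D \<gamma> = D \<beta>")
      case True
      have "D x \<noteq> D \<gamma>" if "x < \<gamma>" for x
      proof
        assume "D x = D \<gamma>"
        then have "0 \<le> (x - \<gamma>) * (f (D \<beta>) - f (D \<alpha>))"
          using demand_optimal[OF demand_subset, of x \<alpha>] True unfolding scaled by simp
        then show False
          using that lt by (simp add: zero_le_mult_iff)
      qed
      moreover have "\<exists>x\<in>{0..1}. \<gamma> - \<epsilon> < x \<and> x < \<gamma>" if "0 < \<epsilon>" for \<epsilon>
        using that \<alpha>\<gamma> \<gamma>\<beta> less.prems
        \<comment> \<open>The maximum with \<alpha> keeps the witness nonnegative; halving
          \<epsilon> makes the lower bound strict.\<close>
        by (intro bexI[of _ "max \<alpha> (\<gamma> - \<epsilon> / 2)"]) (auto simp: max_def)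
      ultimately have "\<forall>\<epsilon>>0. \<exists>x\<in>{0..1}. \<gamma> - \<epsilon> < x \<and> x < \<gamma> \<and> D x \<noteq> D \<gamma>"
        by meson
      then have "\<gamma> \<in> critical_values D"
        using \<alpha>\<gamma> \<gamma>\<beta> less.prems unfolding critical_values_def by simp
      then have ne: "critical_values D \<inter> {\<alpha><..\<beta>} \<noteq> {}"
        using \<alpha>\<gamma> \<gamma>\<beta> by auto
      then have "1 \<le> card (critical_values D \<inter> {\<alpha><..\<beta>})"
        using finite_critical_values by (simp add: Suc_le_eq card_gt_0_iff)
      \<comment> \<open>The critical value \<gamma> pays for this one call, since
        \<open>2 * N - 1\<close> is at least 1.\<close>
      then have "c0 * 1 \<le> c0 * (2 * real (card (critical_values D \<inter> {\<alpha><..\<beta>})) - 1)"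
        using cost_nonneg by (intro mult_left_mono) auto
      then have "cost \<alpha> \<beta> \<le> c0 * (2 * real (card (critical_values D \<inter> {\<alpha><..\<beta>})) - 1)"
        using cost[of \<alpha> \<beta>] by linarith
      then show ?thesis
        using ne CV_run.single[OF less.prems(4) f_ne \<gamma>_def True] by blast
    next
      case False
      have lt2: "f (D \<gamma>) < f (D \<beta>)"
        using reward_demand_mono[OF \<gamma>\<beta>] demand_eqI False by fastforce
      \<comment> \<open>If the demand at \<gamma> were \<open>D \<alpha>\<close>, then
        \<open>D \<beta>\<close>, having the larger reward, would be strictly worse at \<gamma>,
        against the tie.\<close>
      have \<alpha>_ne: "D \<alpha> \<noteq> D \<gamma>"
        using demand_strictly_optimal[OF demand_subset lt2] \<gamma>_tie by auto
      have lt1: "f (D \<alpha>) < f (D \<gamma>)"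
        using reward_demand_mono[of \<alpha> \<gamma>] \<alpha>\<gamma> demand_eqI \<alpha>_ne by fastforce
      have fin: "finite (F x y)" for x y
        using finite_actions unfolding F_def by simp
      \<comment> \<open>The left call loses \<open>D \<beta>\<close>, whose reward exceeds the new
        upper end.\<close>
      have "F \<alpha> \<gamma> \<subseteq> F \<alpha> \<beta>" "D \<beta> \<in> F \<alpha> \<beta>" "D \<beta> \<notin> F \<alpha> \<gamma>"
        using lt lt2 demand_subset unfolding F_def by auto
      then have "card (F \<alpha> \<gamma>) < card (F \<alpha> \<beta>)"
        by (intro psubset_card_mono[OF fin]) blast
      moreover have "\<gamma> \<le> 1"
        using \<gamma>\<beta> less.prems(3) by simp
      ultimately obtain R1 t1 where 1: "critical_values D \<inter> {\<alpha><..\<gamma>} \<noteq> {}"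
        "CV_run D f c cost \<alpha> \<gamma> R1 t1"
        "t1 \<le> c0 * (2 * real (card (critical_values D \<inter> {\<alpha><..\<gamma>})) - 1)"
        using less.hyps[OF _ less.prems(1) less_imp_le[OF \<alpha>\<gamma>] _ \<alpha>_ne] by blast
      \<comment> \<open>The right call loses \<open>D \<gamma>\<close>, which sits at the excluded
        lower end.\<close>
      have "F \<gamma> \<beta> \<subseteq> F \<alpha> \<beta>" "D \<gamma> \<in> F \<alpha> \<beta>" "D \<gamma> \<notin> F \<gamma> \<beta>"
        using lt1 lt2 demand_subset unfolding F_def by auto
      then have "card (F \<gamma> \<beta>) < card (F \<alpha> \<beta>)"
        by (intro psubset_card_mono[OF fin]) blast
      moreover have "0 \<le> \<gamma>"
        using \<alpha>\<gamma> less.prems(1) by simp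
      ultimately obtain R2 t2 where 2: "CV_run D f c cost \<gamma> \<beta> R2 t2"
        "t2 \<le> c0 * (2 * real (card (critical_values D \<inter> {\<gamma><..\<beta>})) - 1)"
        using less.hyps[OF _ _ \<gamma>\<beta> less.prems(3) False] by blast
      \<comment> \<open>Half-open intervals count \<gamma> only on the left, so the two counts add
        up exactly.\<close>
      have union: "critical_values D \<inter> {\<alpha><..\<beta>} =
          (critical_values D \<inter> {\<alpha><..\<gamma>}) \<union> (critical_values D \<inter> {\<gamma><..\<beta>})"
        using \<alpha>\<gamma> \<gamma>\<beta> by auto
      have "card (critical_values D \<inter> {\<alpha><..\<beta>}) =
          card (critical_values D \<inter> {\<alpha><..\<gamma>}) + card (critical_values D \<inter> {\<gamma><..\<beta>})"
        unfolding union using finite_critical_values by (intro card_Un_disjoint) auto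
      \<comment> \<open>With counts \<open>a\<close> and \<open>b\<close>,
        \<open>(2 * a - 1) + (2 * b - 1) + 1 = 2 * (a + b) - 1\<close>: the slack of 1 pays for the
        current call.\<close>
      then have "cost \<alpha> \<beta> + t1 + t2
          \<le> c0 * (2 * real (card (critical_values D \<inter> {\<alpha><..\<beta>})) - 1)"
        using 1(3) 2(2) cost[of \<alpha> \<beta>] by (simp add: algebra_simps)
      moreover have "critical_values D \<inter> {\<alpha><..\<beta>} \<noteq> {}"
        using 1(1) union by blast
      ultimately show ?thesis
        using CV_run.split[OF less.prems(4) f_ne \<gamma>_def False 1(2) 2(1)] by blast
    qed
  qed
qed

end

theorem claim2:
  fixes c0 :: real
  shows "\<exists>C::real. \<forall>(A :: nat set) f c pick cost.
    contract_setting A f c \<and> tie_breaking_rule A pick \<and>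
    (\<forall>\<alpha> \<beta>. 0 \<le> cost \<alpha> \<beta> \<and> cost \<alpha> \<beta> \<le> c0) \<longrightarrow>
    (\<forall>\<alpha> \<beta>. 0 \<le> \<alpha> \<and> \<alpha> \<le> \<beta> \<and> \<beta> \<le> 1 \<longrightarrow>
      finite (critical_values (demand A f c pick) \<inter> {\<alpha>..\<beta>}) \<and>
      (\<exists>R t. CV_run (demand A f c pick) f c cost \<alpha> \<beta> R t \<and>
        t \<le> C * (real (card (critical_values (demand A f c pick) \<inter> {\<alpha>..\<beta>})) + 1)))"
\<comment> \<open>The factor 2 comes from the bound of \<open>2 * N - 1\<close> calls; the summand 1
  in the claim covers a call that returns at once on a segment without critical values.\<close>
proof (intro exI[of _ "2 * c0"] allI impI, elim conjE)
  fix A :: "nat set" and f c pick and cost :: "real \<Rightarrow> real \<Rightarrow> real" and \<alpha> \<beta>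
  assume setting: "contract_setting A f c" "tie_breaking_rule A pick"
    and cost: "\<forall>\<alpha> \<beta>. 0 \<le> cost \<alpha> \<beta> \<and> cost \<alpha> \<beta> \<le> c0"
    and \<alpha>\<beta>: "0 \<le> \<alpha>" "\<alpha> \<le> \<beta>" "\<beta> \<le> (1 :: real)"
  interpret contract A f c pick
    using setting by unfold_locales (auto simp: contract_setting_def)
  let ?N = "card (critical_values D \<inter> {\<alpha>..\<beta>})"
  have c0: "0 \<le> c0"
    using cost by (meson order_trans)
  have fin: "finite (critical_values D \<inter> {\<alpha>..\<beta>})"
    using finite_critical_values by simp
  have "\<exists>R t. CV_run D f c cost \<alpha> \<beta> R t \<and> t \<le> 2 * c0 * (real ?N + 1)"
  proof (cases "D \<alpha> = D \<beta>")
    case True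
    have "c0 * 1 \<le> c0 * (2 * (real ?N + 1))"
      using c0 by (intro mult_left_mono) auto
    then have "cost \<alpha> \<beta> \<le> 2 * c0 * (real ?N + 1)"
      using cost[rule_format, of \<alpha> \<beta>] by (simp add: mult.assoc mult.left_commute)
    then show ?thesis
      using CV_run.same[of D, OF True] by blast
  next
    case False
    obtain R t where run: "CV_run D f c cost \<alpha> \<beta> R t"
      and t: "t \<le> c0 * (2 * real (card (critical_values D \<inter> {\<alpha><..\<beta>})) - 1)"
      using CV_run_linear_time[OF _ c0 \<alpha>\<beta> False] cost by blast
    \<comment> \<open>Passing to the closed segment can only add \<alpha> to the count.\<close>
    have "card (critical_values D \<inter> {\<alpha><..\<beta>}) \<le> ?N"
      using fin by (intro card_mono) auto
    then have "c0 * (2 * real (card (critical_values D \<inter> {\<alpha><..\<beta>})) - 1)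
        \<le> c0 * (2 * (real ?N + 1))"
      using c0 by (intro mult_left_mono) auto
    then have "t \<le> 2 * c0 * (real ?N + 1)"
      using t by (simp add: mult.assoc mult.left_commute)
    then show ?thesis
      using run by blast
  qed
  then show "finite (critical_values D \<inter> {\<alpha>..\<beta>}) \<and>
      (\<exists>R t. CV_run D f c cost \<alpha> \<beta> R t \<and> t \<le> 2 * c0 * (real ?N + 1))"
    using fin by simp
qed

end
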